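(* Let $m,n$ be positive integers with $m\le n$, and let $m'=2^{\lceil \lg m\rceil}$. Then $\widehat{p}(K_{m,n})\le m'\lceil n/m'\rceil$.
   Context: $K_{m,n}$ is the complete bipartite graph with partite sets of sizes $m$ and $n$; $\lg$ is the logarithm to base 2. An edge-coloring of a graph $G$ is any assignment of colors to its edges. A walk is closed if its two endpoints coincide, and open otherwise. A parity walk (in an edge-coloring) is a walk along which every color is used an even number of times (counting repeated traversals). A strong parity edge-coloring (spec) is an edge-coloring in which every parity walk is closed, and $\widehat{p}(G)$ is the minimum number of colors in a spec of $G$. *)

theory Defs
  imports Complex_Main "Graph_Theory.Kuratowski"
begin

text \<open>
  A finite simple graph is a symmetric loop-free digraph without parallel arcs (locale
  \<^locale>\<open>graph\<close>), so each undirected edge is represented by two opposite arcs. An edge-coloring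
  assigns a color to the two-element set of end-vertices, which both arcs share.
\<close>

definition edge_of :: "('a, 'b) pre_digraph \<Rightarrow> 'b \<Rightarrow> 'a set" where
  "edge_of G e = {tail G e, head G e}"

definition edges :: "('a, 'b) pre_digraph \<Rightarrow> 'a set set" where
  "edges G = edge_of G ` arcs G"

definition parity_walk ::
  "('a, 'b) pre_digraph \<Rightarrow> ('a set \<Rightarrow> 'c) \<Rightarrow> 'a \<Rightarrow> 'b awalk \<Rightarrow> 'a \<Rightarrow> bool" where
  "parity_walk G c u p v \<longleftrightarrow>
     pre_digraph.awalk G u p v \<and>
     (\<forall>k. even (count_list (map (\<lambda>e. c (edge_of G e)) p) k))"

definition spec :: "('a, 'b) pre_digraph \<Rightarrow> ('a set \<Rightarrow> 'c) \<Rightarrow> bool" where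
  "spec G c \<longleftrightarrow> (\<forall>u p v. parity_walk G c u p v \<longrightarrow> u = v)"

text \<open>
  Only the colors on edges of \<open>G\<close> count. Natural numbers suffice as colors because the
  graphs considered are finite; giving all edges distinct colors is always a spec, so
  the minimum exists for them.
\<close>

definition spec_number :: "('a, 'b) pre_digraph \<Rightarrow> nat" where
  "spec_number G = (LEAST k. \<exists>c :: 'a set \<Rightarrow> nat. spec G c \<and> card (c ` edges G) = k)"

end

theory Submission
  imports Defs
begin

unbundle bit_operations_syntax

text \<open>
  Label the smaller part by distinct numbers below \<open>m'\<close> and the other part by distinct numbers
  below \<open>n\<close>, and color each edge by the bitwise exclusive or of its two labels. Along a walk the
  exclusive or of the colors telescopes to the exclusive or of the labels of the two ends, and it
  vanishes on a parity walk; so the ends have equal labels. Having even length, the walk ends in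
  the part where it started, where labels are distinct. Since \<open>m'\<close> is a power of two, the labels
  below \<open>m'\<close> preserve the quotient by \<open>m'\<close> of the label they are combined with, which confines
  the colors to \<open>\<lceil>n / m'\<rceil>\<close> blocks of length \<open>m'\<close>.
\<close>

text \<open>Colors are assigned to unordered edges, so the two labels are recovered as the minimum
  and maximum of the image, and commutativity makes their order irrelevant.\<close>

definition xor_coloring :: "('a \<Rightarrow> nat) \<Rightarrow> 'a set \<Rightarrow> nat" where
  "xor_coloring h S = Min (h ` S) XOR Max (h ` S)"

lemma xor_coloring_doubleton [simp]: "xor_coloring h {u, v} = h u XOR h v"
  by (auto simp: xor_coloring_def min_def max_def xor.commute)

lemma xor_left_cancel [simp]: "a XOR (a XOR b) = b" for a b :: nat
  by (simp flip: xor.assoc)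

definition xor_list :: "nat list \<Rightarrow> nat" where
  "xor_list xs = foldr (XOR) xs 0"

lemma xor_list_simps [simp]:
  "xor_list [] = 0"
  "xor_list (x # xs) = x XOR xor_list xs"
  by (simp_all add: xor_list_def)

lemma xor_list_append [simp]: "xor_list (xs @ ys) = xor_list xs XOR xor_list ys"
  by (induction xs) (simp_all add: xor.assoc)

text \<open>The first entry must occur again; deleting both copies keeps all counts even, and their
  images under \<open>t\<close> cancel. The free \<open>t\<close> lets one parity hypothesis serve
  both the colors themselves and a constant weight.\<close>

lemma xor_list_map_eq_0_if_even_counts:
  assumes "\<And>k. even (count_list xs k)"
  shows "xor_list (map t xs) = 0"
  using assms
proof (induction xs rule: length_induct)
  case (1 xs)
  show ?case
  proof (cases xs)
    case (Cons x xs')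
    have "odd (count_list xs' x)"
      using "1.prems"[of x] Cons by simp
    then have "x \<in> set xs'"
      by (metis count_notin even_zero)
    then obtain ys zs where xs': "xs' = ys @ x # zs"
      by (meson split_list)
    have "even (count_list (ys @ zs) k)" for k
      using "1.prems"[of k] by (auto simp: Cons xs' split: if_splits)
    then have "xor_list (map t (ys @ zs)) = 0"
      using "1.IH" by (simp add: Cons xs' del: map_append)
    then show ?thesis
      by (simp add: Cons xs' xor.left_commute)
  qed simp
qed

text \<open>Each inner vertex contributes its label twice, once as a head and once as the next
  tail.\<close>

lemma (in pre_digraph) xor_list_awalk_telescope:
  assumes "awalk u p v"
    and "\<And>e. e \<in> arcs G \<Longrightarrow> w e = h (tail G e) XOR h (head G e)"
  shows "xor_list (map w p) = h u XOR h v"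
proof -
  have "cas u p v" "set p \<subseteq> arcs G"
    using assms(1) by (auto simp: awalk_def)
  then show ?thesis
    by (induction p arbitrary: u) (auto simp: assms(2) xor.assoc)
qed

lemma spec_xor_coloring:
  assumes "wf_digraph G"
    and bip: "\<And>e. e \<in> arcs G \<Longrightarrow> tail G e \<in> V \<longleftrightarrow> head G e \<notin> V"
    and inj: "inj_on h V" "inj_on h (verts G - V)"
  shows "spec G (xor_coloring h)"
  unfolding spec_def
proof (intro allI impI)
  fix u p v
  assume "parity_walk G (xor_coloring h) u p v"
  then have walk: "pre_digraph.awalk G u p v"
    and even: "\<And>k. even (count_list (map (\<lambda>e. xor_coloring h (edge_of G e)) p) k)"
    by (auto simp: parity_walk_def)
  interpret wf_digraph G by fact
  note zero = xor_list_map_eq_0_if_even_counts[OF even, unfolded map_map o_def]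
  have "h u XOR h v = 0"
    using xor_list_awalk_telescope[OF walk, of "\<lambda>e. xor_coloring h (edge_of G e)" h]
      zero[of "\<lambda>x. x"] by (simp add: edge_of_def)
  then have labels: "h u = h v"
    by (metis xor.right_neutral xor_left_cancel)
  \<comment> \<open>Weighting every arc by 1 turns the telescoping sum into the parity of the length.\<close>
  have "xor_list (map (\<lambda>e. 1) p) = of_bool (u \<in> V) XOR of_bool (v \<in> V)"
    by (rule xor_list_awalk_telescope[OF walk]) (auto simp: bip)
  then have side: "u \<in> V \<longleftrightarrow> v \<in> V"
    using zero[of "\<lambda>_. 1"] by (auto split: if_splits simp: of_bool_def)
  have "u \<in> verts G" "v \<in> verts G"
    using walk by (auto intro: awalk_hd_in_verts awalk_last_in_verts)
  then show "u = v"
    using labels side inj by (auto dest: inj_onD)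
qed

lemma spec_number_le_if_colors_less:
  fixes c :: "'a set \<Rightarrow> nat"
  assumes "spec G c" and "\<And>S. S \<in> edges G \<Longrightarrow> c S < N"
  shows "spec_number G \<le> N"
proof -
  have "spec_number G \<le> card (c ` edges G)"
    unfolding spec_number_def using assms(1) by (intro Least_le) blast
  also have "\<dots> \<le> card {..<N}"
    using assms(2) by (intro card_mono) auto
  finally show ?thesis
    by simp
qed

text \<open>Since \<open>a\<close> has only the low \<open>k\<close> bits, the combination leaves
  the quotient of \<open>b\<close> by \<open>2 ^ k\<close> unchanged, and that quotient is below
  \<open>r\<close>.\<close>

lemma xor_less_mult_power_of_two:
  fixes a b :: nat
  assumes "a < 2 ^ k" and "b < 2 ^ k * r"
  shows "a XOR b < 2 ^ k * r"
proof -
  have "(a XOR b) div 2 ^ k = b div 2 ^ k"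
    using assms(1) by (simp flip: drop_bit_eq_div add: drop_bit_xor) (simp add: drop_bit_eq_div)
  also have "\<dots> < r"
    using assms(2) by (simp add: less_mult_imp_div_less mult.commute)
  finally show ?thesis
    by (metis div_less_iff_less_mult mult.commute pos2 zero_less_power)
qed

theorem corollary4p6:
  fixes G :: "('a, 'b) pre_digraph" and m n m' :: nat
  assumes "K\<^bsub>m,n\<^esub> G"
    and "1 \<le> m" and "m \<le> n"
    and "m' = 2 ^ nat \<lceil>log 2 (real m)\<rceil>"
  shows "int (spec_number G) \<le> int m' * \<lceil>real n / real m'\<rceil>"
proof -
  define r where "r = nat \<lceil>real n / real m'\<rceil>"
  have "real m \<le> 2 powr real_of_int \<lceil>log 2 (real m)\<rceil>"
    using assms(2) by (subst le_powr_iff) auto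
  also have "\<dots> = real m'"
  proof -
    \<comment> \<open>As \<open>m\<close> is at least 1, the logarithm is nonnegative, so
      \<open>nat\<close> does not truncate the exponent.\<close>
    have "0 \<le> \<lceil>log 2 (real m)\<rceil>"
      using assms(2) by (simp add: less_le_trans[of "-1" 0])
    then show ?thesis
      by (simp add: assms(4) powr_real_of_int)
  qed
  finally have "m \<le> m'"
    by simp
  have "real n / real m' \<le> real r"
    unfolding r_def by linarith
  then have "real n \<le> real (m' * r)"
    using assms(4) by (simp add: field_simps)
  then have "n \<le> m' * r"
    by linarith
  obtain U V where UV: "verts G = U \<union> V" "U \<inter> V = {}" "card U = m" "card V = n"
    and ends: "arcs_ends G = U \<times> V \<union> V \<times> U" and "graph G"
    using assms(1) by (auto simp: complete_bipartite_digraph_def)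
  interpret graph G by fact
  have "finite U" "finite V"
    using UV(1) finite_verts by auto
  then obtain f g where f: "bij_betw f U {0..<m}" and g: "bij_betw g V {0..<n}"
    using UV ex_bij_betw_finite_nat by metis
  define h where "h v = (if v \<in> V then g v else f v)" for v
  have arcs_between: "tail G e \<in> U \<and> head G e \<in> V \<or> tail G e \<in> V \<and> head G e \<in> U"
    if "e \<in> arcs G" for e
    using that ends by (auto simp: arcs_ends_def arc_to_ends_def)
  have hV: "h v < m' * r" if "v \<in> V" for v
    using bij_betwE[OF g] that \<open>n \<le> m' * r\<close> by (fastforce simp: h_def)
  have hU: "h u < m'" if "u \<in> U" for u
    using bij_betwE[OF f] that \<open>m \<le> m'\<close> UV(2) by (fastforce simp: h_def)
  have "spec G (xor_coloring h)"
  proof (rule spec_xor_coloring)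
    show "wf_digraph G" ..
    show "tail G e \<in> V \<longleftrightarrow> head G e \<notin> V" if "e \<in> arcs G" for e
      using arcs_between[OF that] UV(2) by auto
    show "inj_on h V"
      using g by (auto simp: h_def bij_betw_def inj_on_def)
    show "inj_on h (verts G - V)"
      using f UV(1) by (auto simp: h_def bij_betw_def inj_on_def)
  qed
  moreover have "xor_coloring h S < m' * r" if S: "S \<in> edges G" for S
  proof -
    obtain u v where "u \<in> U" "v \<in> V" "S = {u, v}"
      using S arcs_between by (fastforce simp: edges_def edge_of_def)
    then show ?thesis
      using hU hV assms(4) by (simp add: xor_less_mult_power_of_two)
  qed
  ultimately have "spec_number G \<le> m' * r"
    by (rule spec_number_le_if_colors_less)
  then have "int (spec_number G) \<le> int m' * int r"
    by (simp flip: of_nat_mult)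
  moreover have "int r = \<lceil>real n / real m'\<rceil>"
    \<comment> \<open>Nonnegativity of the ceiling simplifies to its argument exceeding -1, which
      follows through 0.\<close>
    by (simp add: r_def less_le_trans[of "-1" 0])
  ultimately show ?thesis
    by simp
qed

end
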